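(* Let $n\ge 5$. The spectrum (multiset of eigenvalues) of the arrangement graph $A(n,4)$ consists of $$\begin{array}{lll} (-4)^{[n(n-3)(n^2-7n+8)+1]}, & (n-10)^{[n(n-1)(n-5)/6]}, & (n-9)^{[n(n-2)(n-4)]},\\ (n-8)^{[(n-1)(n-2)(n-3)/2]}, & (n-7)^{[2n(n-2)(n-4)/3]}, & (n-6)^{[n(n-1)(n-5)/2]},\\ (n-5)^{[n(n-2)(n-4)]}, & (n-4)^{[(n-1)(n-2)(n-3)/6]}, & (2n-14)^{[n(n-3)/2]},\\ (2n-12)^{[3(n-1)(n-2)/2]}, & (2n-10)^{[3n(n-3)/2]}, & (2n-8)^{[5n(n-3)/2+3]},\\ (3n-16)^{[n-1]}, & (3n-12)^{[3(n-1)]}, & (4n-16)^{[1]}, \end{array}$$ where $\lambda^{[m]}$ denotes eigenvalue $\lambda$ with multiplicity $m$, and when for a particular $n$ several of the listed values coincide, their listed multiplicities are added (only the combined multiplicity of each distinct value is meaningful).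
   Context: A $k$-permutation of $[n]=\{1,\dots,n\}$ is an injective map $\pi:\{1,\dots,k\}\to[n]$. The arrangement graph $A(n,k)$ has as vertices all $k$-permutations of $[n]$, two being adjacent iff they differ in exactly one position $i\in\{1,\dots,k\}$. Eigenvalues of a graph are those of its adjacency matrix. *)

theory Defs
  imports
    Complex_Main
    "Graph_Theory.Pair_Digraph"
    "Jordan_Normal_Form.Char_Poly"
begin

definition k_permutations :: "nat \<Rightarrow> nat \<Rightarrow> (nat \<Rightarrow> nat) set" where
  "k_permutations n k = {\<pi> \<in> {1..k} \<rightarrow>\<^sub>E {1..n}. inj_on \<pi> {1..k}}"

text \<open>An undirected simple graph is encoded by a symmetric, loop-free arc relation.\<close>

definition arrangement_graph :: "nat \<Rightarrow> nat \<Rightarrow> (nat \<Rightarrow> nat) pair_pre_digraph" where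
  "arrangement_graph n k =
     \<lparr> pverts = k_permutations n k,
       parcs = {(\<pi>, \<sigma>). \<pi> \<in> k_permutations n k \<and> \<sigma> \<in> k_permutations n k \<and>
                        (\<exists>!i. i \<in> {1..k} \<and> \<pi> i \<noteq> \<sigma> i)} \<rparr>"

lemma finite_k_permutations: "finite (k_permutations n k)"
  unfolding k_permutations_def
  by (rule finite_subset[of _ "{1..k} \<rightarrow>\<^sub>E {1..n}"]) (auto intro: finite_PiE)

lemma pair_graph_arrangement_graph: "pair_graph (arrangement_graph n k)"
proof
  show "finite (pverts (arrangement_graph n k))"
    by (simp add: arrangement_graph_def finite_k_permutations)
  have "parcs (arrangement_graph n k) \<subseteq> k_permutations n k \<times> k_permutations n k"
    by (auto simp: arrangement_graph_def)
  then show "finite (parcs (arrangement_graph n k))"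
    by (rule finite_subset) (simp add: finite_k_permutations)
  have "sym (parcs (arrangement_graph n k))"
    unfolding arrangement_graph_def sym_def by (simp add: neq_commute)
  then show "symmetric (with_proj (arrangement_graph n k))"
    by (simp add: symmetric_def)
qed (unfold arrangement_graph_def, simp_all add: case_prod_unfold, metis)

text \<open>Rows and columns are indexed by an enumeration \<open>vs\<close> of the vertices. The entries are
  complex so that the characteristic polynomial has all its roots in the field.\<close>

definition adjacency_matrix :: "'v pair_pre_digraph \<Rightarrow> 'v list \<Rightarrow> complex mat" where
  "adjacency_matrix G vs =
     mat (length vs) (length vs) (\<lambda>(i, j). if (vs ! i, vs ! j) \<in> parcs G then 1 else 0)"

text \<open>\<open>has_spectrum G L\<close>: for each \<open>x\<close>, the multiplicity of \<open>x\<close> in the multiset of eigenvalues of \<open>G\<close>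
  is the sum of all \<open>m\<close> with \<open>(x, m)\<close> listed in \<open>L\<close> (and \<open>0\<close> if \<open>x\<close> is not listed). Values may be
  repeated in \<open>L\<close>, and an individual \<open>m\<close> may be zero or negative; only the sums matter. The
  spectrum does not depend on the enumeration \<open>vs\<close>, and the property is required for all of them.\<close>

definition has_spectrum :: "'v pair_pre_digraph \<Rightarrow> (real \<times> real) list \<Rightarrow> bool" where
  "has_spectrum G L \<longleftrightarrow> finite (pverts G) \<and>
     (\<forall>vs. distinct vs \<and> set vs = pverts G \<longrightarrow>
        (\<forall>x. real (count (proots (char_poly (adjacency_matrix G vs))) x) =
             (\<Sum>(ev, m)\<leftarrow>L. if x = complex_of_real ev then m else 0)))"

end

theory Submission
  imports Defs "Jordan_Normal_Form.Schur_Decomposition"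
begin

text \<open>The number of walks of length \<open>m\<close> from a word \<open>x\<close> to a word \<open>y\<close> depends only on the partial
  permutation of positions recording which letters of \<open>x\<close> reappear where in \<open>y\<close>. So powers of the
  adjacency matrix are governed by a step operator on partial permutations of four points, which is
  invariant under conjugation and hence acts on functions of the 20 conjugacy classes, with
  coefficients polynomial in \<open>n\<close>. There the delta function of the identity is an explicit sum of 15
  eigenvectors, so \<open>tr A\<^sup>m = (\<Sum>i. \<mu>\<^sub>i * \<lambda>\<^sub>i\<^sup>m)\<close> for all \<open>m\<close>, with \<open>\<lambda>\<^sub>i\<close> and \<open>\<mu>\<^sub>i\<close> the listed values. All power sums
  together determine the multiset of eigenvalues, also when some of the \<open>\<lambda>\<^sub>i\<close> coincide.\<close>

section \<open>Power sums of eigenvalues\<close>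

lemma sum_diag_mult_commute:
  fixes X Y :: "'a::comm_semiring_0 mat"
  assumes X: "X \<in> carrier_mat N N" and Y: "Y \<in> carrier_mat N N"
  shows "(\<Sum>i<N. (X * Y) $$ (i, i)) = (\<Sum>i<N. (Y * X) $$ (i, i))"
proof -
  have *: "(V * W) $$ (i, i) = (\<Sum>j<N. V $$ (i, j) * W $$ (j, i))"
    if "V \<in> carrier_mat N N" "W \<in> carrier_mat N N" "i < N" for V W :: "'a mat" and i
    using that by (auto simp: scalar_prod_def atLeast0LessThan intro!: sum.cong)
  have "(\<Sum>i<N. (X * Y) $$ (i, i)) = (\<Sum>i<N. \<Sum>j<N. X $$ (i, j) * Y $$ (j, i))"
    using X Y by (simp add: * del: index_mult_mat)
  also have "\<dots> = (\<Sum>i<N. \<Sum>j<N. Y $$ (i, j) * X $$ (j, i))"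
    by (subst sum.swap) (simp add: mult.commute)
  also have "\<dots> = (\<Sum>i<N. (Y * X) $$ (i, i))"
    using X Y by (simp add: * del: index_mult_mat)
  finally show ?thesis .
qed

lemma upper_triangular_power:
  fixes B :: "'a::comm_semiring_1 mat"
  assumes B: "B \<in> carrier_mat N N" and ut: "upper_triangular B"
  shows "upper_triangular (B ^\<^sub>m m) \<and> (\<forall>i<N. (B ^\<^sub>m m) $$ (i, i) = B $$ (i, i) ^ m)"
proof (induction m)
  case 0
  then show ?case using B by auto
next
  case (Suc m)
  let ?P = "B ^\<^sub>m m"
  have P: "?P \<in> carrier_mat N N" using B by simp
  have entry: "(?P * B) $$ (i, j) = (\<Sum>l<N. ?P $$ (i, l) * B $$ (l, j))" if "i < N" "j < N" for i j
    using that B P by (auto simp: scalar_prod_def atLeast0LessThan intro!: sum.cong)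
  have zero: "?P $$ (i, l) = 0" if "l < i" "i < N" for i l
    using Suc that P by (auto simp: upper_triangular_def)
  have zero': "B $$ (l, j) = 0" if "j < l" "l < N" for l j
    using ut that B by (auto simp: upper_triangular_def)
  \<comment> \<open>Every \<open>l\<close> satisfies \<open>l < i\<close> or \<open>l > j\<close>,
    so one of the two factors vanishes.\<close>
  have "(?P * B) $$ (i, j) = 0" if "j < i" "i < N" for i j
    using that by (subst entry) (auto intro!: sum.neutral, metis linorder_cases order.strict_trans mult_zero_left mult_zero_right zero zero')
  moreover have "(?P * B) $$ (i, i) = B $$ (i, i) ^ Suc m" if "i < N" for i
  proof -
    have "(?P * B) $$ (i, i) = (\<Sum>l\<in>{i}. ?P $$ (i, l) * B $$ (l, i))"
      using that by (subst entry; (intro sum.mono_neutral_right)?)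
        (auto, metis linorder_neqE_nat mult_zero_left mult_zero_right zero zero')
    then show ?thesis using Suc that by (simp add: mult.commute)
  qed
  ultimately show ?case using P B by (auto simp: upper_triangular_def)
qed

text \<open>Schur triangularisation over the complex numbers: the roots are the diagonal entries of
  a triangular matrix similar to \<open>A\<close>. Cyclicity of the trace removes the conjugating
  matrices, and taking powers of a triangular matrix takes powers of its diagonal.\<close>

lemma power_sums_char_poly_roots:
  fixes A :: "complex mat"
  assumes A: "A \<in> carrier_mat N N"
  obtains es where "proots (char_poly A) = mset es"
    and "\<And>m. (\<Sum>e\<leftarrow>es. e ^ m) = (\<Sum>i<N. (A ^\<^sub>m m) $$ (i, i))"
proof -
  obtain as where "char_poly A = (\<Prod>a\<leftarrow>as. [:- a, 1:])"
    using char_poly_factorized[OF A] by blast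
  from schur_decomposition_exists[OF A this] obtain B
    where B: "B \<in> carrier_mat N N" and ut: "upper_triangular B" and sim: "similar_mat A B"
    by blast
  from sim obtain P Q where wit: "similar_mat_wit A B P Q"
    unfolding similar_mat_def by blast
  have PQ: "P \<in> carrier_mat N N" "Q \<in> carrier_mat N N" "Q * P = 1\<^sub>m N"
    using similar_mat_witD2[OF A wit] by auto
  have "char_poly A = (\<Prod>a\<leftarrow>diag_mat B. [:- a, 1:])"
    using char_poly_similar[OF sim] char_poly_upper_triangular[OF B ut] by simp
  moreover have "proots (\<Prod>a\<leftarrow>es. [:- a, 1:]) = mset es" for es :: "complex list"
  proof (induction es)
    case (Cons a es)
    have "(\<Prod>a\<leftarrow>es. [:- a, 1:]) \<noteq> 0" by (auto simp: prod_list_zero_iff)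
    then show ?case
      using Cons proots_mult[of "[:- a, 1:]" "\<Prod>a\<leftarrow>es. [:- a, 1:]"]
      by (simp del: mult_pCons_left)
  qed simp
  ultimately have "proots (char_poly A) = mset (diag_mat B)" by simp
  moreover have "(\<Sum>e\<leftarrow>diag_mat B. e ^ m) = (\<Sum>i<N. (A ^\<^sub>m m) $$ (i, i))" for m
  proof -
    have Bm: "B ^\<^sub>m m \<in> carrier_mat N N" using B by simp
    have "(\<Sum>i<N. (A ^\<^sub>m m) $$ (i, i)) = (\<Sum>i<N. (P * (B ^\<^sub>m m * Q)) $$ (i, i))"
      using similar_mat_wit_pow_id[OF wit, of m] PQ Bm by (simp add: assoc_mult_mat[of _ N N _ N _ N])
    also have "\<dots> = (\<Sum>i<N. (B ^\<^sub>m m * Q * P) $$ (i, i))"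
      using PQ Bm by (intro sum_diag_mult_commute) auto
    also have "B ^\<^sub>m m * Q * P = B ^\<^sub>m m"
      using PQ Bm right_mult_one_mat[OF Bm] by (simp add: assoc_mult_mat[of _ N N _ N _ N])
    also have "(\<Sum>i<N. (B ^\<^sub>m m) $$ (i, i)) = (\<Sum>i<N. B $$ (i, i) ^ m)"
      using upper_triangular_power[OF B ut] by simp
    also have "\<dots> = (\<Sum>e\<leftarrow>diag_mat B. e ^ m)"
      using B by (simp add: diag_mat_def comp_def interv_sum_list_conv_sum_set_nat atLeast0LessThan)
    finally show ?thesis by simp
  qed
  ultimately show ?thesis using that by blast
qed

text \<open>Equality of the power sums extends linearly from monomials to a polynomial vanishing at
  every relevant point except \<open>x\<close>.\<close>

lemma count_eq_if_power_sums_eq: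
  fixes es :: "'a::field_char_0 list" and L :: "('a \<times> 'a) list"
  assumes eq: "\<And>m. (\<Sum>e\<leftarrow>es. e ^ m) = (\<Sum>(ev, c)\<leftarrow>L. c * ev ^ m)"
  shows "of_nat (count (mset es) x) = (\<Sum>(ev, c)\<leftarrow>L. if x = ev then c else 0)"
proof -
  have poly_eq: "(\<Sum>e\<leftarrow>es. poly p e) = (\<Sum>(ev, c)\<leftarrow>L. c * poly p ev)" for p
  proof -
    have "(\<Sum>e\<leftarrow>es. poly p e) = (\<Sum>i\<le>degree p. coeff p i * (\<Sum>e\<leftarrow>es. e ^ i))"
      by (induction es) (simp_all add: poly_altdef algebra_simps sum.distrib)
    also have "\<dots> = (\<Sum>(ev, c)\<leftarrow>L. c * poly p ev)"
      unfolding eq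
      by (induction L) (auto simp: poly_altdef algebra_simps sum.distrib sum_distrib_left)
    finally show ?thesis .
  qed
  define S where "S = (set es \<union> fst ` set L) - {x}"
  define p where "p = (\<Prod>y\<in>S. [:- y, 1:])"
  have "finite S" by (simp add: S_def)
  then have zero: "poly p y = 0" if "y \<in> S" for y
    using that by (auto simp: p_def poly_prod)
  have px: "poly p x \<noteq> 0"
    using \<open>finite S\<close> by (auto simp: p_def poly_prod S_def)
  have "(\<Sum>e\<leftarrow>as. poly p e) = of_nat (count (mset as) x) * poly p x"
    if "set as - {x} \<subseteq> S" for as
    using that by (induction as) (auto simp: zero algebra_simps subset_iff)
  then have "(\<Sum>e\<leftarrow>es. poly p e) = of_nat (count (mset es) x) * poly p x"
    by (simp add: S_def Diff_mono)
  moreover have "(\<Sum>(ev, c)\<leftarrow>M. c * poly p ev) = (\<Sum>(ev, c)\<leftarrow>M. if x = ev then c else 0) * poly p x"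
    if "fst ` set M - {x} \<subseteq> S" for M
    using that by (induction M) (auto simp: zero algebra_simps subset_iff)
  then have "(\<Sum>(ev, c)\<leftarrow>L. c * poly p ev) = (\<Sum>(ev, c)\<leftarrow>L. if x = ev then c else 0) * poly p x"
    by (simp add: S_def Diff_mono)
  ultimately show ?thesis using poly_eq[of p] px by simp
qed

section \<open>Walks and patterns\<close>

text \<open>\<open>pattern k x y\<close> has entry \<open>j\<close> at index \<open>i\<close> if \<open>y i = x j\<close>, and entry \<open>0\<close> if \<open>y i\<close> does not occur
  in \<open>x\<close>. The leading \<open>0\<close> aligns list indices with positions and makes the pattern a self-map of
  \<open>{0..k}\<close> fixing \<open>0\<close>.\<close>

definition pattern :: "nat \<Rightarrow> (nat \<Rightarrow> nat) \<Rightarrow> (nat \<Rightarrow> nat) \<Rightarrow> nat list" where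
  "pattern k x y =
     0 # map (\<lambda>i. if y i \<in> x ` {1..k} then inv_into {1..k} x (y i) else 0) [1..<Suc k]"

text \<open>A list rather than a set, so that statements about all patterns can be checked by
  evaluation.\<close>

definition patterns :: "nat \<Rightarrow> nat list list" where
  "patterns k =
     filter (\<lambda>p. \<forall>i\<in>set [1..<Suc k]. \<forall>j\<in>set [1..<Suc k]. p ! i = p ! j \<longrightarrow> p ! i = 0 \<or> i = j)
       (map ((#) 0) (List.n_lists k [0..<Suc k]))"

text \<open>The tail drops the leading \<open>0\<close>, which stands for no position.\<close>

definition holes :: "nat list \<Rightarrow> nat" where
  "holes p = count_list (tl p) 0"

text \<open>The parameter \<open>a\<close> stands for \<open>n - k\<close>.\<close>

definition walk_step :: "real \<Rightarrow> nat \<Rightarrow> (nat list \<Rightarrow> real) \<Rightarrow> nat list \<Rightarrow> real" where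
  "walk_step a k h p =
     (\<Sum>i\<in>{1..k}. (\<Sum>j\<in>{1..k} - set p. h (p[i := j])) + (a - real (holes p)) * h (p[i := 0]))"

lemma length_pattern [simp]: "length (pattern k x y) = Suc k"
  by (simp add: pattern_def)

lemma pattern_nth_0 [simp]: "pattern k x y ! 0 = 0"
  by (simp add: pattern_def)

lemma tl_pattern: "tl (pattern k x y) = map ((!) (pattern k x y)) [1..<Suc k]"
  by (rule nth_equalityI) (auto simp: nth_tl simp del: upt_Suc)

lemma pattern_nth:
  assumes "i \<in> {1..k}"
  shows "pattern k x y ! i = (if y i \<in> x ` {1..k} then inv_into {1..k} x (y i) else 0)"
proof -
  obtain i' where "i = Suc i'" using assms by (cases i) auto
  with assms show ?thesis by (simp add: pattern_def del: upt_Suc)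
qed

lemma pattern_nth_eq_iff:
  assumes x: "inj_on x {1..k}" and i: "i \<in> {1..k}" and j: "j \<in> {1..k}"
  shows "pattern k x y ! i = j \<longleftrightarrow> y i = x j"
proof (cases "y i \<in> x ` {1..k}")
  case True
  then obtain l where "l \<in> {1..k}" "y i = x l" by blast
  then have "pattern k x y ! i = l"
    using i inv_into_f_f[OF x \<open>l \<in> {1..k}\<close>] True by (simp only: pattern_nth if_True)
  then show ?thesis
    using inj_on_eq_iff[OF x \<open>l \<in> {1..k}\<close> j] \<open>y i = x l\<close> by auto
next
  case False
  then show ?thesis using i j by (auto simp: pattern_nth)
qed

lemma pattern_nth_eq_0_iff:
  assumes i: "i \<in> {1..k}"
  shows "pattern k x y ! i = 0 \<longleftrightarrow> y i \<notin> x ` {1..k}"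
  using assms inv_into_into[of "y i" x "{1..k}"] by (auto simp: pattern_nth simp del: inv_into_into)

lemma pattern_self:
  assumes x: "inj_on x {1..k}"
  shows "pattern k x x = [0..<Suc k]"
proof (rule nth_equalityI)
  fix i assume "i < length (pattern k x x)"
  then show "pattern k x x ! i = [0..<Suc k] ! i"
    using pattern_nth_eq_iff[OF x, of i i x] by (cases "i = 0") (auto simp del: upt_Suc)
qed simp

text \<open>Turns the walks of length \<open>0\<close>, which join a word only to itself, into the
  delta function of the identity pattern.\<close>

lemma pattern_eq_id_iff:
  assumes x: "x \<in> k_permutations n k" and y: "y \<in> k_permutations n k"
  shows "pattern k x y = [0..<Suc k] \<longleftrightarrow> y = x"
proof
  assume eq: "pattern k x y = [0..<Suc k]"
  have "y i = x i" if "i \<in> {1..k}" for i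
  proof -
    have "pattern k x y ! i = i" unfolding eq using that by (simp del: upt_Suc)
    then show ?thesis
      using that pattern_nth_eq_iff x by (auto simp: k_permutations_def)
  qed
  \<comment> \<open>Both words are \<open>undefined\<close> outside \<open>{1..k}\<close>, so
    agreement on the positions suffices.\<close>
  then show "y = x"
    using x y PiE_ext[of y "{1..k}" "\<lambda>_. {1..n}" x] by (simp add: k_permutations_def)
next
  assume "y = x"
  then show "pattern k x y = [0..<Suc k]"
    using x by (simp add: pattern_self k_permutations_def)
qed

lemma pattern_update:
  assumes "i \<in> {1..k}"
  shows "pattern k x (y(i := v)) =
    (pattern k x y)[i := if v \<in> x ` {1..k} then inv_into {1..k} x v else 0]"
proof (rule nth_equalityI)
  fix l assume "l < length (pattern k x (y(i := v)))"
  then consider "l = 0" | "l \<in> {1..k}" by fastforce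
  then show "pattern k x (y(i := v)) ! l =
    (pattern k x y)[i := if v \<in> x ` {1..k} then inv_into {1..k} x v else 0] ! l"
  proof cases
    case 1
    then show ?thesis using assms by simp
  next
    case 2
    then show ?thesis using assms by (cases "l = i") (simp_all add: pattern_nth)
  qed
qed simp

lemma mem_set_pattern_iff:
  assumes x: "inj_on x {1..k}" and j: "j \<in> {1..k}"
  shows "j \<in> set (pattern k x y) \<longleftrightarrow> x j \<in> y ` {1..k}"
proof -
  have "j \<in> set (pattern k x y) \<longleftrightarrow> (\<exists>i\<in>{1..k}. pattern k x y ! i = j)"
  proof
    assume "j \<in> set (pattern k x y)"
    then obtain i where "i < Suc k" "pattern k x y ! i = j"
      by (auto simp: in_set_conv_nth)
    moreover have "i \<noteq> 0"
      using \<open>pattern k x y ! i = j\<close> j by (metis atLeastAtMost_iff not_one_le_zero pattern_nth_0)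
    ultimately show "\<exists>i\<in>{1..k}. pattern k x y ! i = j" by auto
  qed (auto intro: nth_mem)
  also have "\<dots> \<longleftrightarrow> (\<exists>i\<in>{1..k}. x j = y i)"
    using pattern_nth_eq_iff[OF x _ j] by metis
  finally show ?thesis unfolding image_iff .
qed

lemma holes_pattern:
  assumes y: "inj_on y {1..k}"
  shows "holes (pattern k x y) = card (y ` {1..k} - x ` {1..k})"
proof -
  have "holes (pattern k x y) = length (filter (\<lambda>i. pattern k x y ! i = 0) [1..<Suc k])"
    unfolding holes_def tl_pattern
    by (simp add: count_list_eq_length_filter filter_map comp_def eq_commute[of 0] del: upt_Suc)
  also have "\<dots> = card ({i. pattern k x y ! i = 0} \<inter> {1..k})"
    by (simp only: distinct_length_filter distinct_upt set_upt atLeastLessThanSuc_atLeastAtMost)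
  also have "{i. pattern k x y ! i = 0} \<inter> {1..k} = {i \<in> {1..k}. y i \<notin> x ` {1..k}}"
    using pattern_nth_eq_0_iff[of _ k x y] by blast
  also have "card \<dots> = card (y ` {i \<in> {1..k}. y i \<notin> x ` {1..k}})"
    by (rule card_image[symmetric], rule inj_on_subset[OF y]) blast
  also have "y ` {i \<in> {1..k}. y i \<notin> x ` {1..k}} = y ` {1..k} - x ` {1..k}"
    by auto
  finally show ?thesis .
qed

lemma mem_patterns_iff:
  "p \<in> set (patterns k) \<longleftrightarrow> length p = Suc k \<and> p ! 0 = 0 \<and> (\<forall>i\<in>{1..k}. p ! i \<le> k) \<and>
    (\<forall>i\<in>{1..k}. \<forall>j\<in>{1..k}. p ! i = p ! j \<longrightarrow> p ! i = 0 \<or> i = j)"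
proof -
  have "p \<in> set (map ((#) 0) (List.n_lists k [0..<Suc k])) \<longleftrightarrow>
      length p = Suc k \<and> p ! 0 = 0 \<and> (\<forall>i\<in>{1..k}. p ! i \<le> k)"
  proof (cases p)
    case (Cons x q)
    have "(\<forall>i\<in>{1..k}. p ! i \<le> k) \<longleftrightarrow> (\<forall>i<k. q ! i \<le> k)"
    proof safe
      fix i assume "\<forall>i\<in>{1..k}. p ! i \<le> k" "i < k"
      then show "q ! i \<le> k" using bspec[of "{1..k}" "\<lambda>i. p ! i \<le> k" "Suc i"] by (simp add: Cons)
    next
      fix i assume "\<forall>i<k. q ! i \<le> k" "i \<in> {1..k}"
      then show "p ! i \<le> k" by (cases i) (simp_all add: Cons)
    qed
    then show ?thesis
      by (auto simp: Cons set_n_lists all_set_conv_all_nth subset_code(1) less_Suc_eq_le simp del: upt_Suc)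
  qed (auto simp: set_n_lists)
  then show ?thesis
    unfolding patterns_def set_filter set_upt atLeastLessThanSuc_atLeastAtMost by blast
qed

text \<open>Filling, replacing and deleting entries stay within the patterns, so the step operators
  can be iterated on functions known only there.\<close>

lemma patterns_update:
  assumes "p \<in> set (patterns k)" and i: "i \<in> {1..k}" and j: "j = 0 \<or> j \<in> {1..k} - set p"
  shows "p[i := j] \<in> set (patterns k)"
proof -
  from assms(1) have len: "length p = Suc k" and "p ! 0 = 0"
    and le: "\<And>l. l \<in> {1..k} \<Longrightarrow> p ! l \<le> k"
    and inj: "\<And>l l'. l \<in> {1..k} \<Longrightarrow> l' \<in> {1..k} \<Longrightarrow> p ! l = p ! l' \<Longrightarrow> p ! l = 0 \<or> l = l'"
    by (auto simp: mem_patterns_iff)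
  have new: "p ! l \<noteq> j" if "l \<in> {1..k}" "j \<noteq> 0" for l
    using that j nth_mem[of l p] len by auto
  show ?thesis
    unfolding mem_patterns_iff
  proof (intro conjI ballI impI)
    show "p[i := j] ! l \<le> k" if "l \<in> {1..k}" for l
      using that le j len i by (cases "l = i") auto
    show "p[i := j] ! l = 0 \<or> l = l'"
      if "l \<in> {1..k}" "l' \<in> {1..k}" "p[i := j] ! l = p[i := j] ! l'" for l l'
      using that inj[of l l'] new[of l] new[of l'] len i by (cases "l = i"; cases "l' = i") auto
  qed (use i \<open>p ! 0 = 0\<close> len in auto)
qed

text \<open>\<open>weight (n - k) p\<close> is the number of words with pattern \<open>p\<close> relative to a given word. The
  eigenfunctions of \<^const>\<open>walk_step\<close> have denominators dividing the weight, which vanishes for small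
  \<open>n\<close>. Hence the passage to \<open>weighted_step\<close>, which has polynomial eigenfunctions.\<close>

definition weight :: "real \<Rightarrow> nat list \<Rightarrow> real" where
  "weight a p = (\<Prod>l<holes p. a - real l)"

definition weighted_step :: "real \<Rightarrow> nat \<Rightarrow> (nat list \<Rightarrow> real) \<Rightarrow> nat list \<Rightarrow> real" where
  "weighted_step a k h p = (\<Sum>i\<in>{1..k}.
     if p ! i = 0 then (a + 1 - real (holes p)) * (\<Sum>j\<in>{1..k} - set p. h (p[i := j])) +
       (a - real (holes p)) * h p
     else (\<Sum>j\<in>{1..k} - set p. h (p[i := j])) + h (p[i := 0]))"

text \<open>The additive form avoids truncated subtraction.\<close>

lemma holes_update:
  assumes "length p = Suc k" and "i \<in> {1..k}"
  shows "holes (p[i := j]) + (if p ! i = 0 then 1 else 0) = holes p + (if j = 0 then 1 else 0)"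
proof -
  obtain x q i' where p: "p = x # q" and i: "i = Suc i'"
    using assms by (cases p; cases i) auto
  have i': "i' < length q" using assms by (simp add: p i)
  \<comment> \<open>The update removes \<open>q ! i'\<close> from the multiset; positivity keeps the
    natural subtraction exact.\<close>
  have "0 < count (mset q) 0" if "q ! i' = 0"
    using nth_mem[OF i'] that by (simp del: count_mset)
  then have "count (mset (q[i' := j])) 0 + (if q ! i' = 0 then 1 else 0) =
      count (mset q) 0 + (if j = 0 then 1 else 0)"
    using i' by (auto simp: mset_update simp del: count_mset)
  then show ?thesis by (simp add: holes_def p i count_mset)
qed

text \<open>Filling one of \<open>z\<close> holes formally divides the weight by
  \<open>a + 1 - z\<close>, replacing an entry keeps it, and deleting one multiplies it by
  \<open>a - z\<close>. These factors become the coefficients of \<open>weighted_step\<close>. They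
  are used in multiplied form only, so the weight may vanish.\<close>

lemma weight_walk_step:
  assumes len: "length p = Suc k"
  shows "weight a p * walk_step a k h p = weighted_step a k (\<lambda>q. weight a q * h q) p"
  unfolding walk_step_def weighted_step_def sum_distrib_left
proof (rule sum.cong[OF refl])
  fix i assume i: "i \<in> {1..k}"
  let ?J = "{1..k} - set p" and ?z = "holes p"
  show "weight a p * ((\<Sum>j\<in>?J. h (p[i := j])) + (a - real ?z) * h (p[i := 0])) =
    (if p ! i = 0 then (\<Sum>j\<in>?J. (a + 1 - real ?z) * (weight a (p[i := j]) * h (p[i := j]))) +
       (a - real ?z) * (weight a p * h p)
     else (\<Sum>j\<in>?J. weight a (p[i := j]) * h (p[i := j])) + weight a (p[i := 0]) * h (p[i := 0]))"
  proof (cases "p ! i = 0")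
    case True
    have "(a + 1 - real ?z) * weight a (p[i := j]) = weight a p" if "j \<in> ?J" for j
    proof -
      have z: "?z = Suc (holes (p[i := j]))"
        using holes_update[OF len i, of j] True that by auto
      show ?thesis unfolding weight_def z by (simp add: mult.commute)
    qed
    then have "weight a p * (\<Sum>j\<in>?J. h (p[i := j])) =
        (\<Sum>j\<in>?J. (a + 1 - real ?z) * (weight a (p[i := j]) * h (p[i := j])))"
      by (simp add: sum_distrib_left mult.assoc[symmetric])
    moreover have "p[i := 0] = p" using True by (metis list_update_id)
    ultimately show ?thesis using True by (simp add: algebra_simps)
  next
    case False
    have "weight a (p[i := j]) = weight a p" if "j \<in> ?J" for j
      using holes_update[OF len i, of j] False that by (auto simp: weight_def)
    moreover have "weight a (p[i := 0]) = weight a p * (a - real ?z)"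
      using holes_update[OF len i, of 0] False by (simp add: weight_def)
    ultimately show ?thesis using False by (simp add: sum_distrib_left distrib_left mult.assoc)
  qed
qed

lemma weighted_step_cong:
  assumes "p \<in> set (patterns k)" and "\<And>q. q \<in> set (patterns k) \<Longrightarrow> g q = h q"
  shows "weighted_step a k g p = weighted_step a k h p"
  unfolding weighted_step_def
proof (rule sum.cong[OF refl])
  fix i assume i: "i \<in> {1..k}"
  have eq: "g (p[i := j]) = h (p[i := j])" if "j = 0 \<or> j \<in> {1..k} - set p" for j
    using assms patterns_update[OF assms(1) i that] by blast
  then have "(\<Sum>j\<in>{1..k} - set p. g (p[i := j])) = (\<Sum>j\<in>{1..k} - set p. h (p[i := j]))"
    by (intro sum.cong refl) blast
  then show "(if p ! i = 0 then (a + 1 - real (holes p)) * (\<Sum>j\<in>{1..k} - set p. g (p[i := j])) +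
       (a - real (holes p)) * g p
     else (\<Sum>j\<in>{1..k} - set p. g (p[i := j])) + g (p[i := 0])) =
    (if p ! i = 0 then (a + 1 - real (holes p)) * (\<Sum>j\<in>{1..k} - set p. h (p[i := j])) +
       (a - real (holes p)) * h p
     else (\<Sum>j\<in>{1..k} - set p. h (p[i := j])) + h (p[i := 0]))"
    using assms eq[of 0] by simp
qed

lemma weight_walk_steps:
  assumes "p \<in> set (patterns k)"
  shows "weight a p * (walk_step a k ^^ m) h p = (weighted_step a k ^^ m) (\<lambda>q. weight a q * h q) p"
  using assms
proof (induction m arbitrary: p)
  case (Suc m)
  have "weight a p * (walk_step a k ^^ Suc m) h p =
      weighted_step a k (\<lambda>q. weight a q * (walk_step a k ^^ m) h q) p"
    using Suc.prems by (simp add: weight_walk_step mem_patterns_iff)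
  also have "\<dots> = (weighted_step a k ^^ Suc m) (\<lambda>q. weight a q * h q) p"
    using Suc by (simp cong: weighted_step_cong)
  finally show ?case .
qed simp

lemma weighted_step_sum_list:
  "weighted_step a k (\<lambda>q. \<Sum>e\<leftarrow>es. c e * g e q) p = (\<Sum>e\<leftarrow>es. c e * weighted_step a k (g e) p)"
proof (induction es)
  case (Cons e es)
  have "weighted_step a k (\<lambda>q. u * f q + h q) p = u * weighted_step a k f p + weighted_step a k h p"
    for u f h
  proof -
    have "(\<Sum>j\<in>J. u * f (p[i := j]) + h (p[i := j])) =
        u * (\<Sum>j\<in>J. f (p[i := j])) + (\<Sum>j\<in>J. h (p[i := j]))" for i J
      by (simp add: sum.distrib sum_distrib_left)
    then show ?thesis
      unfolding weighted_step_def sum_distrib_left[of u "\<lambda>i. if p ! i = 0 then _ i else _ i"]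
        sum.distrib[symmetric]
      by (intro sum.cong refl) (simp add: algebra_simps)
  qed
  with Cons show ?case by simp
qed (auto simp: weighted_step_def intro!: sum.neutral)

lemma weighted_steps_eigenvectors:
  assumes eig: "\<And>e p. e \<in> set es \<Longrightarrow> p \<in> set (patterns k) \<Longrightarrow> weighted_step a k (g e) p = ev e * g e p"
    and start: "\<And>p. p \<in> set (patterns k) \<Longrightarrow> h p = (\<Sum>e\<leftarrow>es. c e * g e p)"
    and "p \<in> set (patterns k)"
  shows "(weighted_step a k ^^ m) h p = (\<Sum>e\<leftarrow>es. c e * ev e ^ m * g e p)"
  using assms(3)
proof (induction m arbitrary: p)
  case 0
  then show ?case by (simp add: start)
next
  case (Suc m)
  have "(weighted_step a k ^^ Suc m) h p =
      weighted_step a k (\<lambda>q. \<Sum>e\<leftarrow>es. (c e * ev e ^ m) * g e q) p"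
    using weighted_step_cong[OF Suc.prems Suc.IH] by simp
  also have "\<dots> = (\<Sum>e\<leftarrow>es. (c e * ev e ^ m) * weighted_step a k (g e) p)"
    by (rule weighted_step_sum_list)
  also have "\<dots> = (\<Sum>e\<leftarrow>es. c e * ev e ^ Suc m * g e p)"
    using Suc.prems by (intro arg_cong[where f = sum_list] map_cong) (simp_all add: eig)
  finally show ?case .
qed

section \<open>Steps in the arrangement graph as steps on patterns\<close>

lemma bij_betw_neighbours:
  assumes y: "y \<in> k_permutations n k"
  shows "bij_betw (\<lambda>(i, v). y(i := v)) ({1..k} \<times> ({1..n} - y ` {1..k}))
    {z. (y, z) \<in> parcs (arrangement_graph n k)}"
proof (rule bij_betw_imageI)
  have inj: "inj_on y {1..k}" and mem: "y \<in> {1..k} \<rightarrow>\<^sub>E {1..n}"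
    using y by (auto simp: k_permutations_def)
  show "inj_on (\<lambda>(i, v). y(i := v)) ({1..k} \<times> ({1..n} - y ` {1..k}))"
  proof (rule inj_onI, clarify)
    fix i v i' v'
    assume *: "i \<in> {1..k}" "v \<notin> y ` {1..k}" "v' \<notin> y ` {1..k}" "y(i := v) = y(i' := v')"
    have "v = (y(i' := v')) i" using fun_cong[OF *(4), of i] by simp
    then show "i = i' \<and> v = v'" using * by (auto split: if_splits)
  qed
  show "(\<lambda>(i, v). y(i := v)) ` ({1..k} \<times> ({1..n} - y ` {1..k})) =
    {z. (y, z) \<in> parcs (arrangement_graph n k)}" (is "?L = ?R")
  proof
    show "?L \<subseteq> ?R"
    proof clarify
      fix i v assume i: "i \<in> {1..k}" and v: "v \<in> {1..n}" "v \<notin> y ` {1..k}"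
      have "y(i := v) \<in> k_permutations n k"
        using inj_on_fun_updI[OF inj v(2)] PiE_fun_upd[of v "\<lambda>_. {1..n}" i, OF _ mem] i v(1)
        by (simp add: k_permutations_def insert_absorb)
      moreover have "\<exists>!l. l \<in> {1..k} \<and> y l \<noteq> (y(i := v)) l"
        using i v by (intro ex1I[of _ i]) (auto split: if_splits)
      ultimately show "(y, y(i := v)) \<in> parcs (arrangement_graph n k)"
        using y by (simp add: arrangement_graph_def)
    qed
    show "?R \<subseteq> ?L"
    proof clarify
      fix z assume "(y, z) \<in> parcs (arrangement_graph n k)"
      then have z: "z \<in> k_permutations n k" and ex1: "\<exists>!i. i \<in> {1..k} \<and> y i \<noteq> z i"
        by (auto simp: arrangement_graph_def)
      from ex1 obtain i where i: "i \<in> {1..k}" "y i \<noteq> z i"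
        and eq: "\<And>l. l \<in> {1..k} \<Longrightarrow> l \<noteq> i \<Longrightarrow> y l = z l" by blast
      have zmem: "z \<in> {1..k} \<rightarrow>\<^sub>E {1..n}" and zinj: "inj_on z {1..k}"
        using z by (simp_all add: k_permutations_def)
      have "z = y(i := z i)"
      proof
        fix l
        show "z l = (y(i := z i)) l"
        proof (cases "l = i \<or> l \<notin> {1..k}")
          case True
          then show ?thesis using PiE_arb[OF mem, of l] PiE_arb[OF zmem, of l] i(1) by auto
        next
          case False
          then show ?thesis using eq[of l] by simp
        qed
      qed
      moreover have "z i \<in> {1..n}"
        using PiE_mem[OF zmem i(1)] .
      moreover have "z i \<noteq> y l" if "l \<in> {1..k}" for l
      proof (cases "l = i")
        case False
        then show ?thesis using eq[OF that] inj_onD[OF zinj _ i(1) that] by auto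
      qed (use i(2) in simp)
      then have "z i \<notin> y ` {1..k}" by blast
      ultimately show "z \<in> ?L"
        using i(1) by (intro image_eqI[of _ _ "(i, z i)"]) simp_all
    qed
  qed
qed

lemma sum_neighbours_pattern:
  assumes x: "x \<in> k_permutations n k" and y: "y \<in> k_permutations n k"
  shows "(\<Sum>z | (y, z) \<in> parcs (arrangement_graph n k). h (pattern k x z)) =
    walk_step (real n - real k) k h (pattern k x y)"
proof -
  let ?K = "{1..k}" and ?p = "pattern k x y"
  let ?idx = "\<lambda>v. if v \<in> x ` ?K then inv_into ?K x v else 0"
  have xi: "inj_on x ?K" and yi: "inj_on y ?K" and xn: "x ` ?K \<subseteq> {1..n}" and yn: "y ` ?K \<subseteq> {1..n}"
    using x y by (auto simp: k_permutations_def)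
  have inner: "(\<Sum>v\<in>{1..n} - y ` ?K. h (?p[i := ?idx v])) =
      (\<Sum>j\<in>?K - set ?p. h (?p[i := j])) + (real n - real k - real (holes ?p)) * h (?p[i := 0])" for i
  proof -
    have "{1..n} - y ` ?K = (x ` ?K - y ` ?K) \<union> ({1..n} - (x ` ?K \<union> y ` ?K))"
      using xn by auto
    then have "(\<Sum>v\<in>{1..n} - y ` ?K. h (?p[i := ?idx v])) =
        (\<Sum>v\<in>x ` ?K - y ` ?K. h (?p[i := ?idx v])) +
        (\<Sum>v\<in>{1..n} - (x ` ?K \<union> y ` ?K). h (?p[i := ?idx v]))"
      by (simp only:) (rule sum.union_disjoint, auto)
    also have "(\<Sum>v\<in>x ` ?K - y ` ?K. h (?p[i := ?idx v])) =
        (\<Sum>j\<in>?K - set ?p. h (?p[i := ?idx (x j)]))"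
    proof (rule sum.reindex_bij_betw[symmetric])
      show "bij_betw x (?K - set ?p) (x ` ?K - y ` ?K)"
        using xi mem_set_pattern_iff[OF xi, of _ y]
        by (intro bij_betw_imageI) (auto intro: inj_on_subset)
    qed
    also have "\<dots> = (\<Sum>j\<in>?K - set ?p. h (?p[i := j]))"
      using xi by (intro sum.cong) (auto simp: inv_into_f_f)
    also have "(\<Sum>v\<in>{1..n} - (x ` ?K \<union> y ` ?K). h (?p[i := ?idx v])) =
        real (card ({1..n} - (x ` ?K \<union> y ` ?K))) * h (?p[i := 0])"
      by simp
    also have "real (card ({1..n} - (x ` ?K \<union> y ` ?K))) = real n - real k - real (holes ?p)"
    proof -
      have "card (x ` ?K \<union> y ` ?K) = card (x ` ?K \<union> (y ` ?K - x ` ?K))" by simp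
      also have "\<dots> = card (x ` ?K) + card (y ` ?K - x ` ?K)"
        by (rule card_Un_disjoint) auto
      also have "\<dots> = k + holes ?p"
        using xi by (simp add: card_image holes_pattern[OF yi])
      finally have c: "card (x ` ?K \<union> y ` ?K) = k + holes ?p" .
      have "card (x ` ?K \<union> y ` ?K) \<le> card {1..n}"
        using xn yn by (intro card_mono) auto
      then show ?thesis
        using xn yn by (subst card_Diff_subset) (simp_all add: c del: One_nat_def)
    qed
    finally show ?thesis .
  qed
  have "(\<Sum>z | (y, z) \<in> parcs (arrangement_graph n k). h (pattern k x z)) =
      (\<Sum>(i, v)\<in>?K \<times> ({1..n} - y ` ?K). h (pattern k x (y(i := v))))"
    using sum.reindex_bij_betw[OF bij_betw_neighbours[OF y], of "\<lambda>z. h (pattern k x z)"]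
    by (simp add: case_prod_unfold)
  also have "\<dots> = (\<Sum>i\<in>?K. \<Sum>v\<in>{1..n} - y ` ?K. h (pattern k x (y(i := v))))"
    by (simp add: sum.cartesian_product)
  also have "\<dots> = (\<Sum>i\<in>?K. \<Sum>v\<in>{1..n} - y ` ?K. h (?p[i := ?idx v]))"
    by (intro sum.cong refl arg_cong[where f = h] pattern_update)
  also have "\<dots> = walk_step (real n - real k) k h ?p"
    unfolding walk_step_def by (simp only: inner)
  finally show ?thesis .
qed

text \<open>The induction splits off the last step of a walk; symmetry turns the arcs into
  \<open>vs ! b\<close> into arcs out of it, over which \<open>sum_neighbours_pattern\<close>
  sums.\<close>

lemma adjacency_matrix_power:
  assumes vs: "distinct vs" "set vs = k_permutations n k" and "a < length vs" "b < length vs"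
  shows "(adjacency_matrix (arrangement_graph n k) vs ^\<^sub>m m) $$ (a, b) =
    complex_of_real ((walk_step (real n - real k) k ^^ m) (\<lambda>p. if p = [0..<Suc k] then 1 else 0)
      (pattern k (vs ! a) (vs ! b)))"
  using assms(3,4)
proof (induction m arbitrary: b)
  case 0
  have "pattern k (vs ! a) (vs ! b) = [0..<Suc k] \<longleftrightarrow> a = b"
    using pattern_eq_id_iff[of "vs ! a" n k "vs ! b"] nth_mem[of a vs] nth_mem[of b vs] 0 vs
    by (auto simp: nth_eq_iff_index_eq)
  then show ?case using 0 by (simp add: adjacency_matrix_def)
next
  case (Suc m)
  let ?G = "arrangement_graph n k" and ?N = "length vs"
  let ?A = "adjacency_matrix ?G vs" and ?x = "vs ! a" and ?y = "vs ! b"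
  let ?u = "(walk_step (real n - real k) k ^^ m) (\<lambda>p. if p = [0..<Suc k] then 1 else 0)"
  have x: "?x \<in> k_permutations n k" and y: "?y \<in> k_permutations n k"
    using Suc.prems vs nth_mem by auto
  have A: "?A \<in> carrier_mat ?N ?N" by (simp add: adjacency_matrix_def)
  have "sym (parcs ?G)"
    unfolding arrangement_graph_def sym_def by (simp add: neq_commute)
  then have sym: "(z, ?y) \<in> parcs ?G \<longleftrightarrow> (?y, z) \<in> parcs ?G" for z
    by (blast dest: symD)
  have "(?A ^\<^sub>m Suc m) $$ (a, b) = (\<Sum>c<?N. (?A ^\<^sub>m m) $$ (a, c) * ?A $$ (c, b))"
    using A pow_carrier_mat[OF A, of m] Suc.prems
    by (auto simp: scalar_prod_def atLeast0LessThan intro!: sum.cong)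
  also have "\<dots> = (\<Sum>c<?N. if (?y, vs ! c) \<in> parcs ?G then complex_of_real (?u (pattern k ?x (vs ! c))) else 0)"
    using Suc by (intro sum.cong refl) (simp add: adjacency_matrix_def sym)
  also have "\<dots> = (\<Sum>z\<in>set vs. if (?y, z) \<in> parcs ?G then complex_of_real (?u (pattern k ?x z)) else 0)"
    by (rule sum.reindex_bij_betw[OF bij_betw_nth[OF vs(1) refl refl]])
  also have "\<dots> = (\<Sum>z | (?y, z) \<in> parcs ?G. complex_of_real (?u (pattern k ?x z)))"
    using vs(2) finite_k_permutations[of n k]
    by (subst sum.inter_filter[symmetric]) (auto intro!: sum.cong simp: arrangement_graph_def)
  also have "\<dots> = complex_of_real (walk_step (real n - real k) k ?u (pattern k ?x ?y))"
    using sum_neighbours_pattern[OF x y, of ?u] by (simp flip: of_real_sum)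
  finally show ?case by simp
qed

lemma card_k_permutations: "card (k_permutations n k) = (\<Prod>i<k. n - i)"
  using card_inj_on_subset_funcset[of "{1..k}" "{1..n}" "{1..k}"]
  by (simp add: k_permutations_def atLeast0LessThan)

section \<open>Conjugacy classes of patterns\<close>

text \<open>The invariants of a pattern \<open>p\<close> are the numbers of fixed points of \<open>p\<close> and \<open>p \<circ> p\<close> and the
  ranks of \<open>p\<close> and \<open>p \<circ> p\<close>. They separate the 20 conjugacy classes of partial permutations of four
  points.\<close>

definition class_key :: "nat list \<Rightarrow> nat list" where
  "class_key p =
     (let fixed = (\<lambda>q. length (filter (\<lambda>i. q ! i = i) [1..<length p]));
          rank = (\<lambda>q. length (filter (\<lambda>i. q ! i \<noteq> 0) [1..<length p]));
          p2 = map ((!) p) p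
      in [fixed p, fixed p2, rank p, rank p2])"

text \<open>Ordered by decreasing rank with the identity first. This order fixes the indices in
  \<open>class_moves\<close> and in the vectors of \<open>eigenrows\<close>.\<close>

definition class_keys :: "nat list list" where
  "class_keys = [
    [4, 4, 4, 4], [0, 4, 4, 4], [0, 0, 4, 4], [2, 4, 4, 4], [1, 1, 4, 4], [0, 2, 3, 2], [0, 0, 3,
     2], [2, 2, 3, 2], [1, 1, 3, 2], [1, 3, 3, 3], [0, 0, 3, 3], [3, 3, 3, 3], [0, 0, 2, 0], [1,
     1, 2, 1], [0, 0, 2, 1], [0, 2, 2, 2], [2, 2, 2, 2], [0, 0, 1, 0], [1, 1, 1, 1], [0, 0, 0, 0]]"

text \<open>An unlisted key would get the index 20, which \<open>class_moves_correct\<close> rules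
  out.\<close>

definition pattern_class :: "nat list \<Rightarrow> nat" where
  "pattern_class p = length (takeWhile (\<lambda>key. key \<noteq> class_key p) class_keys)"

definition filled_classes :: "nat \<Rightarrow> nat list \<Rightarrow> nat list" where
  "filled_classes k p =
     [pattern_class (p[i := j]). i \<leftarrow> [1..<Suc k], j \<leftarrow> [1..<Suc k], p ! i = 0 \<and> j \<notin> set p]"

text \<open>Deletion (\<open>j = 0\<close>) is grouped with replacement because both have
  coefficient 1 in \<open>weighted_step\<close>.\<close>

definition replaced_classes :: "nat \<Rightarrow> nat list \<Rightarrow> nat list" where
  "replaced_classes k p =
     [pattern_class (p[i := j]). i \<leftarrow> [1..<Suc k], j \<leftarrow> [0..<Suc k], p ! i \<noteq> 0 \<and> (j = 0 \<or> j \<notin> set p)]"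

text \<open>An entry \<open>(z, us, ss)\<close> lists the number of holes of a pattern in the class and the classes
  reached by filling a hole (\<open>us\<close>) and by replacing a nonzero entry (\<open>ss\<close>).\<close>

definition class_moves :: "(nat \<times> nat list \<times> nat list) list" where
  "class_moves = [
    (0, [], [11, 11, 11, 11]),
    (0, [], [5, 5, 5, 5]),
    (0, [], [6, 6, 6, 6]),
    (0, [], [7, 7, 9, 9]),
    (0, [], [8, 8, 8, 10]),
    (1, [1], [6, 6, 9, 12, 12, 15]),
    (1, [2], [5, 8, 10, 12, 14, 14]),
    (1, [3], [8, 8, 11, 13, 13, 16]),
    (1, [4], [6, 7, 9, 13, 13, 14]),
    (1, [3], [5, 8, 8, 13, 13, 15]),
    (1, [4], [6, 6, 6, 14, 14, 14]),
    (1, [0], [7, 7, 7, 16, 16, 16]),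
    (2, [5, 5, 6, 6], [13, 13, 14, 14, 17, 17]),
    (2, [7, 8, 8, 9], [12, 13, 14, 16, 17, 18]),
    (2, [6, 6, 8, 10], [12, 13, 14, 15, 17, 17]),
    (2, [5, 5, 9, 9], [14, 14, 14, 14, 17, 17]),
    (2, [7, 7, 11, 11], [13, 13, 13, 13, 18, 18]),
    (3, [12, 12, 13, 13, 14, 14, 14, 14, 15], [17, 17, 18, 19]),
    (3, [13, 13, 13, 13, 13, 13, 16, 16, 16], [17, 17, 17, 19]),
    (4, [17, 17, 17, 17, 17, 17, 17, 17, 17, 17, 17, 17, 18, 18, 18, 18], [])]"

lemma sum_list_concat_map:
  "(\<Sum>x\<leftarrow>concat (map F xs). H x) = (\<Sum>x\<leftarrow>xs. \<Sum>y\<leftarrow>F x. H y)"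
  by (induction xs) simp_all

lemma holes_eq_sum:
  assumes "length p = Suc k"
  shows "real (holes p) = (\<Sum>i\<in>{1..k}. if p ! i = 0 then 1 else 0)"
proof -
  have "tl p = map ((!) p) [1..<Suc k]"
    using assms by (intro nth_equalityI) (auto simp: nth_tl simp del: upt_Suc)
  then have "holes p = length (filter (\<lambda>i. p ! i = 0) [1..<Suc k])"
    by (simp add: holes_def count_list_eq_length_filter filter_map comp_def eq_commute[of 0] del: upt_Suc)
  also have "\<dots> = card ({i. p ! i = 0} \<inter> {1..k})"
    by (simp only: distinct_length_filter distinct_upt set_upt atLeastLessThanSuc_atLeastAtMost)
  finally have "real (holes p) = (\<Sum>i\<in>{i. p ! i = 0} \<inter> {1..k}. 1)" by simp
  also have "\<dots> = (\<Sum>i\<in>{1..k}. if p ! i = 0 then 1 else 0)"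
    by (intro sum.mono_neutral_cong_left) auto
  finally show ?thesis .
qed

lemma sum_filled_classes:
  "(\<Sum>c\<leftarrow>filled_classes k p. H c) =
    (\<Sum>i\<in>{1..k}. if p ! i = 0 then \<Sum>j\<in>{1..k} - set p. H (pattern_class (p[i := j])) else (0::real))"
proof -
  have "(\<Sum>c\<leftarrow>filled_classes k p. H c) = (\<Sum>i\<in>{1..k}. \<Sum>j\<in>{1..k}.
      if p ! i = 0 \<and> j \<notin> set p then H (pattern_class (p[i := j])) else 0)"
    unfolding filled_classes_def sum_list_concat_map interv_sum_list_conv_sum_set_nat
      set_upt atLeastLessThanSuc_atLeastAtMost
    by (intro sum.cong refl) simp
  also have "\<dots> = (\<Sum>i\<in>{1..k}. if p ! i = 0 then \<Sum>j\<in>{1..k} - set p. H (pattern_class (p[i := j])) else 0)"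
    by (intro sum.cong refl) (auto intro!: sum.mono_neutral_cong_right)
  finally show ?thesis .
qed

lemma sum_replaced_classes:
  "(\<Sum>c\<leftarrow>replaced_classes k p. H c) = (\<Sum>i\<in>{1..k}. if p ! i = 0 then 0
     else (\<Sum>j\<in>{1..k} - set p. H (pattern_class (p[i := j]))) + (H (pattern_class (p[i := 0])) :: real))"
proof -
  have *: "{0..k} = insert 0 {1..k}" by auto
  have "(\<Sum>c\<leftarrow>replaced_classes k p. H c) = (\<Sum>i\<in>{1..k}. \<Sum>j\<in>insert 0 {1..k}.
      if p ! i \<noteq> 0 \<and> (j = 0 \<or> j \<notin> set p) then H (pattern_class (p[i := j])) else 0)"
    unfolding replaced_classes_def sum_list_concat_map interv_sum_list_conv_sum_set_nat
      set_upt atLeastLessThanSuc_atLeastAtMost *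
    by (intro sum.cong refl) simp
  also have "\<dots> = (\<Sum>i\<in>{1..k}. if p ! i = 0 then 0
     else (\<Sum>j\<in>{1..k} - set p. H (pattern_class (p[i := j]))) + H (pattern_class (p[i := 0])))"
    by (intro sum.cong refl) (auto intro!: sum.mono_neutral_cong_right)
  finally show ?thesis .
qed

text \<open>On functions of the class, only the classes reached matter. Each hole contributes one
  diagonal term, whence the factor \<open>holes p\<close> in front of
  \<open>a - holes p\<close>.\<close>

lemma weighted_step_class:
  assumes len: "length p = Suc k"
  shows "weighted_step a k (\<lambda>q. H (pattern_class q)) p =
    (a + 1 - real (holes p)) * (\<Sum>c\<leftarrow>filled_classes k p. H c) +
    (\<Sum>c\<leftarrow>replaced_classes k p. H c) + real (holes p) * (a - real (holes p)) * H (pattern_class p)"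
proof -
  have "real (holes p) * (a - real (holes p)) * H (pattern_class p) =
      (\<Sum>i\<in>{1..k}. if p ! i = 0 then (a - real (holes p)) * H (pattern_class p) else 0)"
    unfolding mult.assoc by (subst (1) holes_eq_sum[OF len], unfold sum_distrib_right, intro sum.cong) auto
  then show ?thesis
    unfolding weighted_step_def sum_filled_classes sum_replaced_classes
    by (simp only: sum_distrib_left sum.distrib[symmetric]) (intro sum.cong refl, simp add: sum_distrib_left)
qed

text \<open>Evaluation over all 209 partial permutations of four points shows directly that the
  moves depend on the class only, without an argument about conjugation. Sorting compares the lists
  as multisets.\<close>

lemma class_moves_correct:
  "\<forall>p\<in>set (patterns 4). pattern_class p < length class_moves \<and>
     class_moves ! pattern_class p = (holes p, sort (filled_classes 4 p), sort (replaced_classes 4 p)) \<and>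
     (pattern_class p = 0 \<longleftrightarrow> p = [0..<Suc 4])"
  by code_simp

section \<open>Eigenvectors\<close>

text \<open>In a row \<open>(ev, c, v)\<close>, the vector \<open>c v\<close> is the projection of \<open>r (r - 1) (r - 2) (r - 3)\<close> times the
  delta function of the identity to the eigenspace of \<open>ev\<close>, indexed by classes. It was found by
  interpolation in \<open>r = n\<close>. The identity is class \<open>0\<close>, so \<open>c * v ! 0\<close> is the multiplicity.\<close>

definition eigenrows :: "real \<Rightarrow> (real \<times> real \<times> real list) list" where
  "eigenrows r = [
    (-4, 1,
      [r^4 - 10 * r^3 + 29 * r^2 - 24 * r + 1, 1, - 1, - (r^2 - 3 * r + 1), - (r - 1), - 1, 1,
       r^2 - 3 * r + 1, r - 1, r^2 - 3 * r + 1, r - 1,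
       - (r^4 - 10 * r^3 + 29 * r^2 - 24 * r + 1), 0, - (r * (r - 2)), - r, - (r * (r - 3)),
       r * (r - 3) * (r^2 - 7 * r + 7), r * (r - 1), - (r * (r - 1) * (r^2 - 9 * r + 17)),
       r * (r - 1) * (r - 2) * (r - 7)]),
    (r - 10, r * (r - 1) * (r - 5) / 24,
      [4, 4, 4, 4, 4, r - 10, r - 10, r - 10, r - 10, r - 10, r - 10, r - 10, - (4 * (r - 8)),
       - (4 * (r - 8)), - (4 * (r - 8)), - (4 * (r - 8)), - (4 * (r - 8)), 6 * (3 * r - 22),
       6 * (3 * r - 22), - (96 * (r - 7))]),
    (r - 9, r * (r - 2) * (r - 4) / 24,
      [24, - 8, - 8, 8, 0, - (2 * (r - 9)), - (2 * (r - 9)), 4 * (r - 7), r - 5, - 8,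
       - (3 * (r - 5)), 6 * (r - 9), 8 * (r - 7), - (2 * (3 * r - 19)), 2 * (3 * r - 19),
       4 * (r - 5), - (4 * (5 * r - 33)), - (16 * (r - 6)), 48 * (r - 6), 0]),
    (r - 8, (r - 1) * (r - 2) * (r - 3) / 24,
      [12, - 4, 4, - 4, 0, - (r - 8), r - 8, r, - (r - 4), - (3 * r - 16), 3 * (r - 4),
       3 * (r - 8), 0, 4 * (r - 5), - (4 * (r - 5)), 8 * (r - 5), - (8 * (r - 5)), 0, 0, 0]),
    (r - 7, r * (r - 2) * (r - 4) / 12,
      [8, 8, 0, 0, - 4, 2 * (r - 7), 0, 0, - (r - 7), 0, - (r - 7), 2 * (r - 7), - (4 * (r - 5)),
       2 * (r - 5), 2 * (r - 5), - (4 * (r - 5)), - (4 * (r - 5)), 0, 0, 0]),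
    (r - 6, r * (r - 1) * (r - 5) / 24,
      [12, - 4, - 4, 4, 0, - (r - 6), - (r - 6), - (r + 2), - (r - 2), 3 * r - 10, 3 * (r - 2),
       3 * (r - 6), 4 * (r - 4), 4, - 4, - (4 * (r - 2)), - (4 * (r - 6)), - (2 * (r - 6)),
       6 * (r - 6), 0]),
    (r - 5, r * (r - 2) * (r - 4) / 24,
      [24, - 8, 8, - 8, 0, - (2 * (r - 5)), 2 * (r - 5), - (4 * (r - 3)), r - 1, 8,
       - (3 * (r - 1)), 6 * (r - 5), 0, 2 * (r - 5), - (2 * (r - 5)), 4 * (r - 5),
       - (4 * (r - 5)), 0, 0, 0]),
    (r - 4, (r - 1) * (r - 2) * (r - 3) / 24,
      [4, 4, - 4, - 4, 4, r - 4, - (r - 4), - (r - 4), r - 4, - (r - 4), r - 4, r - 4, 0, 0, 0,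
       0, 0, 0, 0, 0]),
    (2 * r - 14, r * (r - 3) / 12,
      [6, 6, 6, 6, 6, 3 * (r - 7), 3 * (r - 7), 3 * (r - 7), 3 * (r - 7), 3 * (r - 7),
       3 * (r - 7), 3 * (r - 7), r^2 - 21 * r + 92, r^2 - 21 * r + 92, r^2 - 21 * r + 92,
       r^2 - 21 * r + 92, r^2 - 21 * r + 92, - (9 * (r - 6) * (r - 9)),
       - (9 * (r - 6) * (r - 9)), 72 * (r - 6) * (r - 7)]),
    (2 * r - 12, (r - 1) * (r - 2) / 8,
      [12, - 4, - 4, 4, 0, - (2 * (r - 6)), - (2 * (r - 6)), 4 * (r - 5), r - 4, - 4,
       - (3 * (r - 4)), 6 * (r - 6), 8 * (r - 5), (r - 5) * (r - 8), - ((r - 5) * (r - 8)),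
       - (2 * (r - 4) * (r - 5)), 2 * (r - 5) * (r - 12), 4 * (r - 5) * (r - 6),
       - (12 * (r - 5) * (r - 6)), 0]),
    (2 * r - 10, r * (r - 3) / 4,
      [6, - 2, - 2, 2, 0, - (r - 5), - (r - 5), r - 7, - 1, r - 3, 3, 3 * (r - 5),
       - ((r - 4) * (r - 5)), - (2 * (r - 5)), 2 * (r - 5), r * (r - 5), (r - 5) * (r - 8),
       (r - 5) * (r - 6), - (3 * (r - 5) * (r - 6)), 0]),
    (2 * r - 8, 1 / 24,
      [12 * (5 * r^2 - 15 * r + 6), 12 * (r^2 - 3 * r - 2), 12 * (r - 1) * (r - 2),
       - (12 * (r - 1) * (r - 2)), - (12 * r * (r - 3)), 6 * (r - 4) * (r^2 - 3 * r - 2),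
       6 * (r - 1) * (r - 2) * (r - 4), 0, - (3 * (r - 4) * (3 * r^2 - 9 * r + 2)),
       - (12 * (r - 1) * (r - 2) * (r - 4)), 3 * (r - 4) * (r^2 - 3 * r + 6),
       6 * (r - 4) * (5 * r^2 - 15 * r + 6), 4 * r * (r - 3) * (r - 4) * (r - 5),
       - ((r - 4) * (r - 5) * (5 * r^2 - 15 * r + 6)), (r - 4) * (r - 5) * (r^2 - 3 * r + 6),
       - (2 * (r - 4) * (r - 5) * (r^2 - 3 * r + 6)),
       2 * (r - 4) * (r - 5) * (5 * r^2 - 15 * r + 6), 0, 0, 0]),
    (3 * r - 16, (r - 1) / 4,
      [4, 4, 4, 4, 4, 3 * r - 16, 3 * r - 16, 3 * r - 16, 3 * r - 16, 3 * r - 16, 3 * r - 16,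
       3 * r - 16, 2 * (r - 5) * (r - 8), 2 * (r - 5) * (r - 8), 2 * (r - 5) * (r - 8),
       2 * (r - 5) * (r - 8), 2 * (r - 5) * (r - 8), (r - 5) * (r - 6) * (r - 16),
       (r - 5) * (r - 6) * (r - 16), - (16 * (r - 5) * (r - 6) * (r - 7))]),
    (3 * r - 12, (r - 1) / 4,
      [12, - 4, - 4, 4, 0, - (3 * (r - 4)), - (3 * (r - 4)), 5 * (r - 4), r - 4, r - 4,
       - (3 * (r - 4)), 9 * (r - 4), - (2 * (r - 4) * (r - 5)), 2 * (r - 4) * (r - 5),
       - (2 * (r - 4) * (r - 5)), - (2 * (r - 4) * (r - 5)), 6 * (r - 4) * (r - 5),
       - ((r - 4) * (r - 5) * (r - 6)), 3 * (r - 4) * (r - 5) * (r - 6), 0]),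
    (4 * r - 16, 1,
      [1, 1, 1, 1, 1, r - 4, r - 4, r - 4, r - 4, r - 4, r - 4, r - 4, (r - 4) * (r - 5),
       (r - 4) * (r - 5), (r - 4) * (r - 5), (r - 4) * (r - 5), (r - 4) * (r - 5),
       (r - 4) * (r - 5) * (r - 6), (r - 4) * (r - 5) * (r - 6),
       (r - 4) * (r - 5) * (r - 6) * (r - 7)])]"

text \<open>The eigenvalue equation for the formula of \<open>weighted_step_class\<close> at
  \<open>a = r - 4\<close>, so that \<open>a + 1\<close> becomes \<open>r - 3\<close>.\<close>

definition class_eigenvector :: "real \<Rightarrow> real \<Rightarrow> real list \<Rightarrow> bool" where
  "class_eigenvector r ev v \<longleftrightarrow> (\<forall>c<length class_moves. case class_moves ! c of (z, us, ss) \<Rightarrow>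
     (r - 3 - real z) * (\<Sum>c'\<leftarrow>us. v ! c') + (\<Sum>c'\<leftarrow>ss. v ! c') + real z * (r - 4 - real z) * v ! c
       = ev * v ! c)"

text \<open>Unrolls the quantifier into 20 instances in which \<open>simp\<close> can evaluate the
  table lookups.\<close>

lemma all_classes_iff:
  "(\<forall>c<length class_moves. P c) \<longleftrightarrow>
     list_all P [0, 1, 2, 3, 4, 5, 6, 7, 8, 9, 10, 11, 12, 13, 14, 15, 16, 17, 18, 19]"
proof -
  have "[0, 1, 2, 3, 4, 5, 6, 7, 8, 9, 10, 11, 12, 13, 14, 15, 16, 17, 18, 19] = [0..<length class_moves]"
    unfolding class_moves_def by code_simp
  then show ?thesis by (auto simp: list_all_iff)
qed

text \<open>For each row and class this is a polynomial identity in \<open>r\<close>, hence valid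
  for every real \<open>r\<close>, even if eigenvalues coincide.\<close>

lemma class_eigenvectors:
  "\<forall>(ev, c, v)\<in>set (eigenrows r). class_eigenvector r ev v"
  unfolding class_eigenvector_def all_classes_iff
  by (simp add: eigenrows_def class_moves_def) (intro conjI disjI2; Groebner_Basis.algebra)

text \<open>The eigenvectors add up to a multiple of the delta function at the identity, the start
  of the walk count.\<close>

lemma class_eigenvectors_sum:
  "\<forall>c'<length class_moves. (\<Sum>(ev, c, v)\<leftarrow>eigenrows r. c * v ! c') =
     (if c' = 0 then r * (r - 1) * (r - 2) * (r - 3) else 0)"
  unfolding all_classes_iff
  by (simp add: eigenrows_def) (intro conjI; (simp add: field_simps)?; Groebner_Basis.algebra?)

lemma sum_list_map_sort: "(\<Sum>x\<leftarrow>sort xs. f x) = (\<Sum>x\<leftarrow>xs. f x)" for f :: "nat \<Rightarrow> real"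
  by (metis mset_map mset_sort sum_mset_sum_list)

lemma weighted_step_eigenrow:
  assumes "(ev, c, v) \<in> set (eigenrows r)" and p: "p \<in> set (patterns 4)"
  shows "weighted_step (r - 4) 4 (\<lambda>q. v ! pattern_class q) p = ev * v ! pattern_class p"
proof -
  have len: "length p = Suc 4" using p by (simp add: mem_patterns_iff)
  have less: "pattern_class p < length class_moves"
    and moves: "class_moves ! pattern_class p =
      (holes p, sort (filled_classes 4 p), sort (replaced_classes 4 p))"
    using class_moves_correct p by auto
  have "class_eigenvector r ev v" using class_eigenvectors[of r] assms(1) by auto
  then have "(r - 3 - real (holes p)) * (\<Sum>c\<leftarrow>filled_classes 4 p. v ! c) +
      (\<Sum>c\<leftarrow>replaced_classes 4 p. v ! c) +
      real (holes p) * (r - 4 - real (holes p)) * v ! pattern_class p = ev * v ! pattern_class p"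
    unfolding class_eigenvector_def using less moves by (auto simp: sum_list_map_sort)
  then show ?thesis by (simp add: weighted_step_class[OF len] algebra_simps)
qed

section \<open>From eigenvectors to the spectrum\<close>

text \<open>For \<open>r = n\<close> the factor \<open>N\<close> is the number of vertices, so the
  left side becomes a trace.\<close>

lemma closed_walks_at_vertex:
  fixes r :: real
  defines "N \<equiv> r * (r - 1) * (r - 2) * (r - 3)"
  assumes "N \<noteq> 0"
  shows "N * (walk_step (r - 4) 4 ^^ m) (\<lambda>p. if p = [0..<Suc 4] then 1 else 0) [0..<Suc 4] =
    (\<Sum>(ev, c, v)\<leftarrow>eigenrows r. c * v ! 0 * ev ^ m)"
proof -
  let ?id = "[0..<Suc 4]" and ?\<delta> = "\<lambda>p. if p = [0..<Suc 4] then 1 else (0::real)"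
  have id: "?id \<in> set (patterns 4)"
    by (auto simp: mem_patterns_iff simp del: upt_Suc)
  have holes: "holes [0..<5] = 0" by (simp add: holes_def upt_rec)
  have cls: "pattern_class p < length class_moves" "pattern_class p = 0 \<longleftrightarrow> p = ?id"
    if "p \<in> set (patterns 4)" for p
    using class_moves_correct that by auto
  have start: "?\<delta> p = (\<Sum>e\<leftarrow>eigenrows r. fst (snd e) / N * snd (snd e) ! pattern_class p)"
    if "p \<in> set (patterns 4)" for p
  proof -
    have "N * (\<Sum>e\<leftarrow>eigenrows r. fst (snd e) / N * snd (snd e) ! pattern_class p) =
        (\<Sum>(ev, c, v)\<leftarrow>eigenrows r. c * v ! pattern_class p)"
      using \<open>N \<noteq> 0\<close> by (simp add: sum_list_const_mult[symmetric] case_prod_unfold)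
    also have "\<dots> = N * ?\<delta> p"
      using class_eigenvectors_sum[of r] cls[OF that] by (simp add: N_def del: upt_Suc)
    finally show ?thesis using \<open>N \<noteq> 0\<close> by simp
  qed
  have "(walk_step (r - 4) 4 ^^ m) ?\<delta> ?id = weight (r - 4) ?id * (walk_step (r - 4) 4 ^^ m) ?\<delta> ?id"
    by (simp add: weight_def holes)
  also have "\<dots> = (weighted_step (r - 4) 4 ^^ m) (\<lambda>p. weight (r - 4) p * ?\<delta> p) ?id"
    by (rule weight_walk_steps[OF id])
  \<comment> \<open>The identity has no holes, so its weight is the empty product 1.\<close>
  also have "(\<lambda>p. weight (r - 4) p * ?\<delta> p) = ?\<delta>"
    by (simp add: fun_eq_iff weight_def holes)
  also have "(weighted_step (r - 4) 4 ^^ m) ?\<delta> ?id =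
      (\<Sum>e\<leftarrow>eigenrows r. fst (snd e) / N * fst e ^ m * snd (snd e) ! pattern_class ?id)"
    using start id
    by (intro weighted_steps_eigenvectors[where g = "\<lambda>e p. snd (snd e) ! pattern_class p"])
      (auto intro: weighted_step_eigenrow)
  finally show ?thesis
    using \<open>N \<noteq> 0\<close> cls(2)[OF id]
    by (simp add: sum_list_const_mult[symmetric] case_prod_unfold mult.commute mult.left_commute del: upt_Suc)
qed

text \<open>All diagonal entries of a power of the adjacency matrix agree, since every word has the
  identity pattern relative to itself. The trace is therefore the vertex count times one closed-walk
  count.\<close>

lemma has_spectrum_eigenrows:
  assumes n: "n \<ge> 4"
  shows "has_spectrum (arrangement_graph n 4) (map (\<lambda>(ev, c, v). (ev, c * v ! 0)) (eigenrows (real n)))"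
  unfolding has_spectrum_def
proof (intro conjI allI impI)
  let ?G = "arrangement_graph n 4" and ?r = "real n"
  let ?L = "map (\<lambda>(ev, c, v). (ev, c * v ! 0)) (eigenrows ?r)"
  show "finite (pverts ?G)"
    by (simp add: arrangement_graph_def finite_k_permutations)
  fix vs x
  assume "distinct vs \<and> set vs = pverts ?G"
  then have vs: "distinct vs" "set vs = k_permutations n 4"
    by (simp_all add: arrangement_graph_def)
  let ?A = "adjacency_matrix ?G vs" and ?N = "length vs"
  have "?A \<in> carrier_mat ?N ?N" by (simp add: adjacency_matrix_def)
  then obtain es where es: "proots (char_poly ?A) = mset es"
    and trace: "\<And>m. (\<Sum>e\<leftarrow>es. e ^ m) = (\<Sum>i<?N. (?A ^\<^sub>m m) $$ (i, i))"
    by (rule power_sums_char_poly_roots) blast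
  have "?N = card (k_permutations n 4)" using vs distinct_card by metis
  also have "\<dots> = n * (n - 1) * (n - 2) * (n - 3)"
    by (simp add: card_k_permutations lessThan_nat_numeral lessThan_Suc)
  finally have N: "real ?N = ?r * (?r - 1) * (?r - 2) * (?r - 3)"
    using n by (simp add: of_nat_diff)
  have power_sum: "(\<Sum>e\<leftarrow>es. e ^ m) =
      (\<Sum>(ev, c)\<leftarrow>map (\<lambda>(ev, c). (complex_of_real ev, complex_of_real c)) ?L. c * ev ^ m)" for m
  proof -
    let ?w = "(walk_step (?r - 4) 4 ^^ m) (\<lambda>p. if p = [0..<Suc 4] then 1 else 0)"
    have "(?A ^\<^sub>m m) $$ (i, i) = complex_of_real (?w [0..<Suc 4])" if "i < ?N" for i
    proof -
      have "vs ! i \<in> k_permutations n 4" using that vs nth_mem by blast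
      then have "pattern 4 (vs ! i) (vs ! i) = [0..<Suc 4]"
        by (intro pattern_self) (simp add: k_permutations_def)
      then show ?thesis using adjacency_matrix_power[OF vs that that, of m] by (simp del: upt_Suc)
    qed
    then have "(\<Sum>e\<leftarrow>es. e ^ m) = complex_of_real (real ?N * ?w [0..<Suc 4])"
      by (simp add: trace del: upt_Suc)
    also have "real ?N * ?w [0..<Suc 4] = (\<Sum>(ev, c, v)\<leftarrow>eigenrows ?r. c * v ! 0 * ev ^ m)"
      unfolding N by (rule closed_walks_at_vertex) (use n in auto)
    \<comment> \<open>Stated for arbitrary \<open>rows\<close> to permit induction.\<close>
    also have "complex_of_real (\<Sum>(ev, c, v)\<leftarrow>rows. c * v ! 0 * ev ^ m) =
        (\<Sum>(ev, c)\<leftarrow>map (\<lambda>(ev, c). (complex_of_real ev, complex_of_real c))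
          (map (\<lambda>(ev, c, v). (ev, c * v ! 0)) rows). c * ev ^ m)" for rows :: "(real \<times> real \<times> real list) list"
      by (induction rows) auto
    finally show ?thesis .
  qed
  \<comment> \<open>The comparison takes place in the complex numbers, where the roots lie;
    injectivity of the embedding brings it back to the reals.\<close>
  have "complex_of_real (real (count (proots (char_poly ?A)) x)) = of_nat (count (mset es) x)"
    by (simp add: es)
  also have "\<dots> = (\<Sum>(ev, c)\<leftarrow>map (\<lambda>(ev, c). (complex_of_real ev, complex_of_real c)) ?L.
      if x = ev then c else 0)"
    by (rule count_eq_if_power_sums_eq[OF power_sum])
  also have "(\<Sum>(ev, c)\<leftarrow>map (\<lambda>(ev, c). (complex_of_real ev, complex_of_real c)) L. if x = ev then c else 0) =
      complex_of_real (\<Sum>(ev, c)\<leftarrow>L. if x = complex_of_real ev then c else 0)" for L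
    by (induction L) auto
  finally show "real (count (proots (char_poly ?A)) x) =
      (\<Sum>(ev, m)\<leftarrow>?L. if x = complex_of_real ev then m else 0)"
    by (simp only: of_real_eq_iff)
qed

theorem theorem11:
  fixes n :: nat
  assumes "n \<ge> 5"
  shows "let r = real n in
    has_spectrum (arrangement_graph n 4)
      [(-4, r * (r - 3) * (r^2 - 7 * r + 8) + 1),
       (r - 10, r * (r - 1) * (r - 5) / 6),
       (r - 9, r * (r - 2) * (r - 4)),
       (r - 8, (r - 1) * (r - 2) * (r - 3) / 2),
       (r - 7, 2 * r * (r - 2) * (r - 4) / 3),
       (r - 6, r * (r - 1) * (r - 5) / 2),
       (r - 5, r * (r - 2) * (r - 4)),
       (r - 4, (r - 1) * (r - 2) * (r - 3) / 6),
       (2 * r - 14, r * (r - 3) / 2),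
       (2 * r - 12, 3 * (r - 1) * (r - 2) / 2),
       (2 * r - 10, 3 * r * (r - 3) / 2),
       (2 * r - 8, 5 * r * (r - 3) / 2 + 3),
       (3 * r - 16, r - 1),
       (3 * r - 12, 3 * (r - 1)),
       (4 * r - 16, 1)]"
  unfolding Let_def
\<comment> \<open>It remains to match the two lists entry by entry, that is, to simplify each
  \<open>c * v ! 0\<close> to the stated multiplicity.\<close>
proof (rule back_subst[of "has_spectrum (arrangement_graph n 4)", OF has_spectrum_eigenrows])
  show "4 \<le> n" using assms by simp
qed (simp add: eigenrows_def, intro conjI; (simp add: field_simps)?; Groebner_Basis.algebra?)

end
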